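(* Let $f\colon[0,1]\times\mathbb{R}\to\mathbb{R}$ be continuous with $f(t,\mathbb{R}_+)\subset\mathbb{R}_+$ for all $t\in[0,1]$. Assume that there exist positive numbers $\alpha,\beta$, $\alpha\ne\beta$, such that $$\alpha\le (J\underline{f_\alpha})(1)\qquad\text{and}\qquad \beta\ge(J\overline{f_\beta})(1),$$ where $$\underline{f_\alpha}(t)=\min\{f(t,u): M(t)\alpha\le u\le\alpha\},\qquad \overline{f_\beta}(t)=\max\{f(t,u): M(t)\beta\le u\le\beta\}.$$ Then the boundary value problem $$u^{(4)}(t)-f(t,u(t))=0\ \ (0<t<1),\qquad u(0)=u'(0)=u''(1)=u'''(1)=0$$ has at least one positive solution $u$ such that $R_0\le\|u\|_\infty\le R_1$, where $R_0=\min\{\alpha,\beta\}$ and $R_1=\max\{\alpha,\beta\}$.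
   Context: $\mathbb{R}_+=[0,\infty)$; $\|u\|_\infty=\max_{t\in[0,1]}|u(t)|$; $M(t)=\frac{(3-t)t^2}{3}$ for $t\in[0,1]$. For $v\in L^2(0,1)$, $(Jv)(t)=\int_0^1G(t,s)v(s)\,ds$, where $G$ is the Green's function of $u^{(4)}=v$, $u(0)=u'(0)=u''(1)=u'''(1)=0$: $$G(t,s)=\begin{cases}\frac{s^2}{6}(3t-s),&0\le s\le t\le1,\\[2pt] \frac{t^2}{6}(3s-t),&0\le t<s\le1.\end{cases}$$ A solution of the problem is a classical one ($u\in C^4[0,1]$); it is positive if it is nonnegative on $[0,1]$ and not identically zero. *)

theory Defs
  imports "HOL-Analysis.Analysis"
begin

(* Minimum and maximum of a real function over a set, as least and greatest element of the image.
   Junk value if the extremum is not attained; below, g is always continuous and S compact. *)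

definition min_on :: "('a \<Rightarrow> real) \<Rightarrow> 'a set \<Rightarrow> real" where
  "min_on g S = (LEAST y. y \<in> g ` S)"

definition max_on :: "('a \<Rightarrow> real) \<Rightarrow> 'a set \<Rightarrow> real" where
  "max_on g S = (GREATEST y. y \<in> g ` S)"

definition sup_norm :: "(real \<Rightarrow> real) \<Rightarrow> real" where
  "sup_norm u = max_on (\<lambda>t. \<bar>u t\<bar>) {0..1}"

definition M :: "real \<Rightarrow> real" where
  "M t = (3 - t) * t\<^sup>2 / 3"

definition G :: "real \<Rightarrow> real \<Rightarrow> real" where
  "G t s = (if s \<le> t then s\<^sup>2 / 6 * (3 * t - s) else t\<^sup>2 / 6 * (3 * s - t))"

definition J :: "(real \<Rightarrow> real) \<Rightarrow> real \<Rightarrow> real" where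
  "J v t = (LINT s:{0..1}|lebesgue. G t s * v s)"

definition f_lower :: "(real \<Rightarrow> real \<Rightarrow> real) \<Rightarrow> real \<Rightarrow> real \<Rightarrow> real" where
  "f_lower f \<alpha> t = min_on (f t) {M t * \<alpha>..\<alpha>}"

definition f_upper :: "(real \<Rightarrow> real \<Rightarrow> real) \<Rightarrow> real \<Rightarrow> real \<Rightarrow> real" where
  "f_upper f \<beta> t = max_on (f t) {M t * \<beta>..\<beta>}"

(* Derivative of a function on [0,1], one-sided at the end points; only its values on [0,1]
   are meaningful, and they depend only on the values of u there. *)

definition deriv01 :: "(real \<Rightarrow> real) \<Rightarrow> real \<Rightarrow> real" where
  "deriv01 u t = vector_derivative u (at t within {0..1})"

definition C_k01 :: "nat \<Rightarrow> (real \<Rightarrow> real) \<Rightarrow> bool" where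
  "C_k01 k u \<longleftrightarrow>
     (\<forall>j<k. (deriv01 ^^ j) u differentiable_on {0..1}) \<and>
     continuous_on {0..1} ((deriv01 ^^ k) u)"

definition bvp_solution :: "(real \<Rightarrow> real \<Rightarrow> real) \<Rightarrow> (real \<Rightarrow> real) \<Rightarrow> bool" where
  "bvp_solution f u \<longleftrightarrow>
     C_k01 4 u \<and>
     (\<forall>t\<in>{0<..<1}. (deriv01 ^^ 4) u t - f t (u t) = 0) \<and>
     u 0 = 0 \<and> deriv01 u 0 = 0 \<and> (deriv01 ^^ 2) u 1 = 0 \<and> (deriv01 ^^ 3) u 1 = 0"

definition positive01 :: "(real \<Rightarrow> real) \<Rightarrow> bool" where
  "positive01 u \<longleftrightarrow> (\<forall>t\<in>{0..1}. 0 \<le> u t) \<and> (\<exists>t\<in>{0..1}. u t \<noteq> 0)"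

end

(* For nonnegative v, J v lies between M * (J v)(1) and (J v)(1) and so has norm (J v)(1). Look for
   a fixed point in polar form u = r w with r in [R0,R1] and M <= w <= 1, w(1) = 1. With
   rho = J(f(.,r w))(1), the pair (r, w) is sent to (clamp(r + sigma (rho - r)), J(f(.,r w)) / rho),
   where sigma = sgn(beta - alpha); the second component is modified where rho < R0 so that it stays
   in the same set. By the hypotheses at alpha and beta the clamped increment of r points into
   [R0,R1] at both ends, so rho = r at a fixed point, which Schauder's theorem provides. Choosing the
   sign of sigma treats the compressive and the expansive case at once, without an index theory. *)

theory Submission
  imports Defs "HOL-Complex_Analysis.Great_Picard"
begin

text \<open>Functions with \<open>M t * r \<le> u t \<le> r = u 1\<close> and r in
  \<open>{R0..R1}\<close> form a convex set, but u |-> J(f(.,u)) need not map it into itself: the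
  hypotheses control the norm of the image only at r = \<open>\<alpha>\<close> and r =
  \<open>\<beta>\<close>, and for \<open>\<beta> < \<alpha>\<close> they push it outwards.
  Separating radius from shape removes this obstacle: for positive r the equation u = J(f(.,u))
  amounts to rho = r together with w = J(f(.,r w)) / rho, and the scalar radial half can be reversed
  in sign without touching the shape. The division is a second obstacle, since f may vanish and rho
  may be 0 at intermediate radii. The modification below R0 keeps the map continuous there; it
  disappears at a fixed point, where rho = r is at least R0. Since w(1) = 1, the radius is recovered
  as h(1) from the single function h = r w. Schauder's theorem is therefore needed only for
  continuous functions with values in an interval \<open>{a..b}\<close>, and Brouwer's theorem only
  for cubes.\<close>

section \<open>Brouwer's theorem on cubes of variable dimension\<close>

text \<open>Brouwer's theorem in the library is stated for a type of fixed dimension, whereas the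
  finite-dimensional approximations below need every dimension; hence points are functions on
  the naturals and only the coordinates below n matter.\<close>

lemma kuhn_approximate_fixed_point:
  fixes F :: "(nat \<Rightarrow> real) \<Rightarrow> nat \<Rightarrow> real" and p :: nat
  assumes "0 < p"
    and F_range: "\<And>x i. \<lbrakk>\<And>j. x j \<in> {0..1}; i < n\<rbrakk> \<Longrightarrow> F x i \<in> {0..1}"
  shows "\<exists>z a b. (\<forall>j. z j \<in> {0..1}) \<and>
    (\<forall>i<n. (\<forall>j. a i j \<in> {0..1} \<and> b i j \<in> {0..1} \<and>
                \<bar>a i j - z j\<bar> \<le> 1 / p \<and> \<bar>b i j - z j\<bar> \<le> 1 / p) \<and>
           a i i \<le> F (a i) i \<and> F (b i) i \<le> b i i)"
proof -
  \<comment> \<open>Coordinates from n on are frozen at 0, so membership in the cube and closeness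
    hold for every j.\<close>
  define E where "E x j = (if j < n then real (x j) / p else 0)" for x :: "nat \<Rightarrow> nat" and j
  \<comment> \<open>Label 0 records \<open>E x i \<le> F (E x) i\<close>, label 1 the reverse
    inequality. On the faces, where Kuhn's lemma prescribes the label, it remains truthful because F
    takes values in [0,1].\<close>
  define lab where
    "lab x i = (if x i = p \<or> x i \<noteq> 0 \<and> F (E x) i < E x i then 1 else 0 :: nat)" for x i
  have E01: "E x j \<in> {0..1}" if "\<forall>i<n. x i \<le> p" for x j
    using that \<open>0 < p\<close> by (auto simp: E_def)
  have lab0: "E x i \<le> F (E x) i" if "\<forall>i<n. x i \<le> p" "i < n" "lab x i = 0" for x i
    using F_range[of "E x" i] E01[OF that(1)] that by (auto simp: lab_def E_def split: if_splits)
  have lab1: "F (E x) i \<le> E x i" if "\<forall>i<n. x i \<le> p" "i < n" "lab x i = 1" for x i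
    using F_range[of "E x" i] E01[OF that(1)] that \<open>0 < p\<close>
    by (auto simp: lab_def E_def split: if_splits)
  obtain q where q: "\<forall>i<n. q i < p"
    and rs: "\<forall>i<n. \<exists>r s. (\<forall>j<n. q j \<le> r j \<and> r j \<le> q j + 1) \<and>
                 (\<forall>j<n. q j \<le> s j \<and> s j \<le> q j + 1) \<and> lab r i \<noteq> lab s i"
    by (rule kuhn_lemma[of p n lab]) (use \<open>0 < p\<close> in \<open>auto simp: lab_def\<close>)
  have near: "\<bar>E x j - E q j\<bar> \<le> 1 / p" if "\<forall>j<n. q j \<le> x j \<and> x j \<le> q j + 1" for x j
    using that[rule_format, of j] \<open>0 < p\<close>
    by (auto simp: E_def diff_divide_distrib[symmetric] abs_if divide_simps)
  have "\<exists>a b. (\<forall>j. a j \<in> {0..1} \<and> b j \<in> {0..1} \<and>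
                \<bar>a j - E q j\<bar> \<le> 1 / p \<and> \<bar>b j - E q j\<bar> \<le> 1 / p) \<and>
           a i \<le> F a i \<and> F b i \<le> b i" if "i < n" for i
  proof -
    obtain r s where rs: "\<forall>j<n. q j \<le> r j \<and> r j \<le> q j + 1" "\<forall>j<n. q j \<le> s j \<and> s j \<le> q j + 1"
      "lab r i = 0" "lab s i = 1"
    proof -
      obtain r s where "\<forall>j<n. q j \<le> r j \<and> r j \<le> q j + 1" "\<forall>j<n. q j \<le> s j \<and> s j \<le> q j + 1"
        "lab r i \<noteq> lab s i" using rs \<open>i < n\<close> by blast
      moreover from this have "lab r i = 0 \<and> lab s i = 1 \<or> lab s i = 0 \<and> lab r i = 1"
        by (auto simp: lab_def split: if_splits)
      ultimately show ?thesis using that by blast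
    qed
    have le: "\<forall>i<n. r i \<le> p" "\<forall>i<n. s i \<le> p"
      using q rs(1,2) by (metis Suc_eq_plus1 Suc_leI le_trans)+
    show ?thesis
      using E01[OF le(1)] E01[OF le(2)] near[OF rs(1)] near[OF rs(2)]
        lab0[OF le(1) \<open>i < n\<close> rs(3)] lab1[OF le(2) \<open>i < n\<close> rs(4)] by blast
  qed
  then obtain a b where "\<forall>i<n. (\<forall>j. a i j \<in> {0..1} \<and> b i j \<in> {0..1} \<and>
                \<bar>a i j - E q j\<bar> \<le> 1 / p \<and> \<bar>b i j - E q j\<bar> \<le> 1 / p) \<and>
           a i i \<le> F (a i) i \<and> F (b i) i \<le> b i i"
    by metis
  with E01[of q] q show ?thesis by (metis less_imp_le)
qed

text \<open>Tychonoff's theorem; it yields subsequences that converge in all coordinates at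
  once.\<close>

lemma compact_PiE_UNIV:
  fixes S :: "'i \<Rightarrow> 'b::topological_space set"
  assumes "\<And>i. compact (S i)"
  shows "compact (PiE UNIV S)"
  using assms compactin_PiE[of "\<lambda>_. euclidean" UNIV S]
  by (simp add: euclidean_product_topology)

text \<open>Each coordinate i has its own pair of bracketing points \<open>a\<close>,
  \<open>b\<close>, but as the mesh shrinks all of them converge to the same x, and the two
  inequalities squeeze \<open>F x i\<close> to \<open>x i\<close>. Continuity is required along
  coordinatewise convergent sequences, the form in which it is available for nodal values.\<close>

lemma brouwer_cube_nat:
  fixes F :: "(nat \<Rightarrow> real) \<Rightarrow> nat \<Rightarrow> real"
  assumes F_range: "\<And>x i. \<lbrakk>\<And>j. x j \<in> {0..1}; i < n\<rbrakk> \<Longrightarrow> F x i \<in> {0..1}"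
    and F_cont: "\<And>X x i. \<lbrakk>\<And>k j. X k j \<in> {0..1}; \<And>j. x j \<in> {0..1};
      \<And>j. (\<lambda>k. X k j) \<longlonglongrightarrow> x j; i < n\<rbrakk> \<Longrightarrow> (\<lambda>k. F (X k) i) \<longlonglongrightarrow> F x i"
  obtains x where "\<And>j. x j \<in> {0..1}" "\<And>i. i < n \<Longrightarrow> F x i = x i"
proof -
  have "\<exists>z a b. (\<forall>j. z j \<in> {0..1}) \<and>
    (\<forall>i<n. (\<forall>j. a i j \<in> {0..1} \<and> b i j \<in> {0..1} \<and>
          \<bar>a i j - z j\<bar> \<le> 1 / real (Suc m) \<and> \<bar>b i j - z j\<bar> \<le> 1 / real (Suc m)) \<and>
           a i i \<le> F (a i) i \<and> F (b i) i \<le> b i i)" for m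
    by (rule kuhn_approximate_fixed_point) (use F_range in auto)
  then obtain z a b where z: "\<And>m j. z m j \<in> {0..1}"
    and ab: "\<And>m i. i < n \<Longrightarrow> (\<forall>j. a m i j \<in> {0..1} \<and> b m i j \<in> {0..1} \<and>
          \<bar>a m i j - z m j\<bar> \<le> 1 / real (Suc m) \<and> \<bar>b m i j - z m j\<bar> \<le> 1 / real (Suc m)) \<and>
           a m i i \<le> F (a m i) i \<and> F (b m i) i \<le> b m i i"
    by metis
  have "seq_compact (PiE UNIV (\<lambda>_::nat. {0..1::real}))"
    by (intro compact_imp_seq_compact compact_PiE_UNIV compact_Icc)
  then obtain x r where x: "x \<in> PiE UNIV (\<lambda>_::nat. {0..1::real})" and r: "strict_mono r"
    and lim: "(z \<circ> r) \<longlonglongrightarrow> x"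
    by (rule seq_compactE[of _ z]) (use z in auto)
  have x01: "x j \<in> {0..1}" for j using x by auto
  have zx: "(\<lambda>k. z (r k) j) \<longlonglongrightarrow> x j" for j
  proof -
    have "continuous_on UNIV (\<lambda>y::nat \<Rightarrow> real. y j)"
      by (rule continuous_on_product_coordinates)
    from continuous_on_tendsto_compose[OF this lim] show ?thesis by (simp add: o_def)
  qed
  have inv: "(\<lambda>k. 1 / real (Suc (r k))) \<longlonglongrightarrow> 0"
    using LIMSEQ_subseq_LIMSEQ[OF lim_1_over_n[THEN LIMSEQ_Suc] r] by (simp add: o_def)
  have close: "(\<lambda>k. c k) \<longlonglongrightarrow> x j" if "\<And>k. \<bar>c k - z (r k) j\<bar> \<le> 1 / real (Suc (r k))" for c j
  proof -
    have "(\<lambda>k. c k - z (r k) j) \<longlonglongrightarrow> 0"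
      by (rule Lim_null_comparison[OF _ inv]) (use that in auto)
    from tendsto_add[OF this zx[of j]] show ?thesis by simp
  qed
  have "F x i = x i" if "i < n" for i
  proof (rule antisym)
    have lima: "(\<lambda>k. a (r k) i j) \<longlonglongrightarrow> x j" and limb: "(\<lambda>k. b (r k) i j) \<longlonglongrightarrow> x j" for j
      using ab[OF that] by (auto intro!: close)
    have "(\<lambda>k. F (a (r k) i) i) \<longlonglongrightarrow> F x i" "(\<lambda>k. F (b (r k) i) i) \<longlonglongrightarrow> F x i"
      using ab[OF that] by (auto intro!: F_cont x01 lima limb that)
    then show "x i \<le> F x i" "F x i \<le> x i"
      using lima[of i] limb[of i] ab[OF that] by (auto intro: LIMSEQ_le)
  qed
  with x01 show ?thesis using that by blast
qed

section \<open>Schauder's theorem for equicontinuous operators\<close>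

text \<open>Tent functions of radius d around a finite d-net, divided by their sum; the sum is
  positive because every point is closer than d to some centre.\<close>

lemma partition_of_unity_net:
  fixes S :: "'a::metric_space set"
  assumes "compact S" "0 < d"
  shows "\<exists>n c \<phi>. (\<forall>i<n. c i \<in> S \<and> continuous_on S (\<phi> i) \<and>
      (\<forall>s\<in>S. 0 \<le> \<phi> i s \<and> (\<phi> i s \<noteq> 0 \<longrightarrow> dist (c i) s < d))) \<and>
    (\<forall>s\<in>S. (\<Sum>i<n::nat. \<phi> i s :: real) = 1)"
proof -
  obtain k where k: "finite k" "k \<subseteq> S" "S \<subseteq> (\<Union>x\<in>k. ball x d)"
    using seq_compact_imp_totally_bounded[OF compact_imp_seq_compact[OF \<open>compact S\<close>],
        rule_format, OF \<open>0 < d\<close>] by blast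
  obtain c where c: "bij_betw c {0..<card k} k"
    using ex_bij_betw_nat_finite[OF k(1)] by blast
  define \<psi> where "\<psi> i s = max 0 (d - dist (c i) s)" for i :: nat and s
  define \<sigma> where "\<sigma> s = (\<Sum>i<card k. \<psi> i s)" for s
  have pos: "0 < \<sigma> s" if "s \<in> S" for s
  proof -
    obtain x where "x \<in> k" "dist x s < d" using k(3) \<open>s \<in> S\<close> by auto
    moreover from this have "x \<in> c ` {0..<card k}"
      using bij_betw_imp_surj_on[OF c] by simp
    then obtain i where "i < card k" "x = c i" by auto
    ultimately show ?thesis
      unfolding \<sigma>_def by (intro sum_pos2[of _ i]) (auto simp: \<psi>_def)
  qed
  have "continuous_on S (\<psi> i)" for i
    unfolding \<psi>_def by (intro continuous_intros)
  moreover from this have "continuous_on S \<sigma>"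
    unfolding \<sigma>_def by (intro continuous_intros) auto
  ultimately have "continuous_on S (\<lambda>s. \<psi> i s / \<sigma> s)" for i
    using pos by (intro continuous_on_divide) (auto simp: less_imp_neq[symmetric])
  moreover have "c i \<in> S" if "i < card k" for i
    using bij_betw_imp_surj_on[OF c] k(2) that by auto
  moreover have "(\<Sum>i<card k. \<psi> i s / \<sigma> s) = 1" if "s \<in> S" for s
    using pos[OF that] by (simp add: sum_divide_distrib[symmetric] \<sigma>_def[symmetric])
  moreover have "0 \<le> \<psi> i s / \<sigma> s" if "s \<in> S" for i s
    using pos[OF that] by (simp add: \<psi>_def)
  moreover have "dist (c i) s < d" if "\<psi> i s / \<sigma> s \<noteq> 0" for i s
    using that by (auto simp: \<psi>_def max_def split: if_splits)
  ultimately show ?thesis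
    by (intro exI[of _ "card k"] exI[of _ c] exI[of _ "\<lambda>i s. \<psi> i s / \<sigma> s"]) blast
qed

text \<open>The modulus in \<open>\<Phi>_equicont\<close> is uniform over all admissible h and
  stands in for relative compactness of the image. In return, \<open>\<Phi>_cont\<close> asks only
  for pointwise convergence of the images.\<close>

context
  fixes S :: "'a::euclidean_space set" and \<Phi> :: "('a \<Rightarrow> real) \<Rightarrow> 'a \<Rightarrow> real" and a b :: real
  assumes "compact S" and "a < b"
    and \<Phi>_range: "\<And>h s. \<lbrakk>continuous_on S h; h ` S \<subseteq> {a..b}; s \<in> S\<rbrakk> \<Longrightarrow> \<Phi> h s \<in> {a..b}"
    and \<Phi>_equicont: "\<And>e. 0 < e \<Longrightarrow> \<exists>d>0. \<forall>h s t. continuous_on S h \<longrightarrow> h ` S \<subseteq> {a..b} \<longrightarrow>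
        s \<in> S \<longrightarrow> t \<in> S \<longrightarrow> dist s t < d \<longrightarrow> \<bar>\<Phi> h s - \<Phi> h t\<bar> < e"
    and \<Phi>_cont: "\<And>H h s. \<lbrakk>\<And>n. continuous_on S (H n); \<And>n. H n ` S \<subseteq> {a..b};
        continuous_on S h; h ` S \<subseteq> {a..b}; uniform_limit S H h sequentially; s \<in> S\<rbrakk>
        \<Longrightarrow> (\<lambda>n. \<Phi> (H n) s) \<longlonglongrightarrow> \<Phi> h s"
begin

text \<open>Brouwer is applied to nodal values: x determines the interpolant \<open>h x\<close> on a
  net, and is sent to the values of \<open>\<Phi> (h x)\<close> at the nodes, rescaled to [0,1]. At
  a fixed x, \<open>h x s\<close> is a weighted mean of values of \<open>\<Phi> (h x)\<close> at
  nodes near s, hence within e of \<open>\<Phi> (h x) s\<close>.\<close>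

lemma approximate_fixed_function:
  assumes "0 < e"
  obtains h where "continuous_on S h" "h ` S \<subseteq> {a..b}" "\<And>s. s \<in> S \<Longrightarrow> \<bar>\<Phi> h s - h s\<bar> \<le> e"
proof -
  obtain d where "0 < d" and d: "\<And>h s t. \<lbrakk>continuous_on S h; h ` S \<subseteq> {a..b};
      s \<in> S; t \<in> S; dist s t < d\<rbrakk> \<Longrightarrow> \<bar>\<Phi> h s - \<Phi> h t\<bar> < e"
    using \<Phi>_equicont[OF assms] by blast
  from partition_of_unity_net[OF \<open>compact S\<close> \<open>0 < d\<close>]
  obtain n c \<phi> where net: "\<forall>i<n. c i \<in> S \<and> continuous_on S (\<phi> i) \<and>
      (\<forall>s\<in>S. 0 \<le> \<phi> i s \<and> (\<phi> i s \<noteq> 0 \<longrightarrow> dist (c i) s < d))"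
    "\<forall>s\<in>S. (\<Sum>i<n::nat. \<phi> i s :: real) = 1"
    by (elim exE conjE)
  then have c: "\<And>i. i < n \<Longrightarrow> c i \<in> S"
    and cont: "\<And>i. i < n \<Longrightarrow> continuous_on S (\<phi> i)"
    and nonneg: "\<And>i s. i < n \<Longrightarrow> s \<in> S \<Longrightarrow> 0 \<le> \<phi> i s"
    and near: "\<And>i s. i < n \<Longrightarrow> s \<in> S \<Longrightarrow> \<phi> i s \<noteq> 0 \<Longrightarrow> dist (c i) s < d"
    and sum1: "\<And>s. s \<in> S \<Longrightarrow> (\<Sum>i<n. \<phi> i s) = 1"
    by auto
  define h where "h x s = (\<Sum>i<n. (a + (b - a) * x i) * \<phi> i s)" for x s
  have h_cont: "continuous_on S (h x)" for x
    unfolding h_def by (intro continuous_intros cont) auto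
  have h_range: "h x ` S \<subseteq> {a..b}" if "\<And>j. x j \<in> {0..1}" for x
  proof safe
    fix s assume "s \<in> S"
    have "a + (b - a) * x i \<in> {a..b}" for i
    proof -
      have "0 \<le> (b - a) * x i" "(b - a) * x i \<le> b - a"
        using that[of i] \<open>a < b\<close> by (auto intro: mult_left_le)
      then show ?thesis by simp
    qed
    then have "(\<Sum>i<n. a * \<phi> i s) \<le> h x s" "h x s \<le> (\<Sum>i<n. b * \<phi> i s)"
      unfolding h_def using nonneg[OF _ \<open>s \<in> S\<close>] by (auto intro!: sum_mono mult_right_mono)
    then show "h x s \<in> {a..b}"
      using sum1[OF \<open>s \<in> S\<close>] by (simp add: sum_distrib_left[symmetric])
  qed
  have h_lim: "uniform_limit S (\<lambda>k. h (X k)) (h x) sequentially"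
    if "\<And>j. (\<lambda>k. X k j) \<longlonglongrightarrow> x j" for X x
  proof (rule uniform_limitI)
    fix \<epsilon> :: real assume "0 < \<epsilon>"
    have "(\<lambda>k. \<Sum>i<n. (b - a) * \<bar>X k i - x i\<bar>) \<longlonglongrightarrow> (\<Sum>i<n. (b - a) * \<bar>x i - x i\<bar>)"
      by (intro tendsto_intros that)
    then have "\<forall>\<^sub>F k in sequentially. (\<Sum>i<n. (b - a) * \<bar>X k i - x i\<bar>) < \<epsilon>"
      using \<open>0 < \<epsilon>\<close> by (intro order_tendstoD(2)[where y = 0]) auto
    then show "\<forall>\<^sub>F k in sequentially. \<forall>s\<in>S. dist (h (X k) s) (h x s) < \<epsilon>"
    proof (rule eventually_mono, intro ballI)
      fix k s assume lt: "(\<Sum>i<n. (b - a) * \<bar>X k i - x i\<bar>) < \<epsilon>" and "s \<in> S"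
      have le1: "\<phi> i s \<le> 1" if "i < n" for i
        using member_le_sum[of i "{..<n}" "\<lambda>i. \<phi> i s"] that nonneg[OF _ \<open>s \<in> S\<close>] sum1[OF \<open>s \<in> S\<close>]
        by auto
      have "h (X k) s - h x s = (\<Sum>i<n. (b - a) * (X k i - x i) * \<phi> i s)"
        unfolding h_def sum_subtractf[symmetric] by (intro sum.cong) (auto simp: algebra_simps)
      also have "\<bar>\<dots>\<bar> \<le> (\<Sum>i<n. (b - a) * \<bar>X k i - x i\<bar>)"
        using \<open>a < b\<close> le1 nonneg[OF _ \<open>s \<in> S\<close>]
        by (intro order_trans[OF sum_abs] sum_mono) (auto simp: abs_mult intro!: mult_left_le)
      finally show "dist (h (X k) s) (h x s) < \<epsilon>" using lt by (simp add: dist_real_def)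
    qed
  qed
  obtain x where x: "\<And>j. x j \<in> {0..1}"
    and fixed: "\<And>i. i < n \<Longrightarrow> (\<Phi> (h x) (c i) - a) / (b - a) = x i"
  proof (rule brouwer_cube_nat[of n "\<lambda>x i. (\<Phi> (h x) (c i) - a) / (b - a)"])
    fix x assume "\<And>j. x j \<in> {0..1}" "\<And>i. i < n \<Longrightarrow> (\<Phi> (h x) (c i) - a) / (b - a) = x i"
    then show thesis by (rule that)
  next
    show "(\<Phi> (h x) (c i) - a) / (b - a) \<in> {0..1}" if "\<And>j. x j \<in> {0..1}" "i < n" for x i
      using \<Phi>_range[OF h_cont h_range[OF that(1)] c[OF that(2)]] \<open>a < b\<close> by (simp add: divide_simps)
    show "(\<lambda>k. (\<Phi> (h (X k)) (c i) - a) / (b - a)) \<longlonglongrightarrow> (\<Phi> (h x) (c i) - a) / (b - a)"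
      if "\<And>k j. X k j \<in> {0..1}" "\<And>j. x j \<in> {0..1}" "\<And>j. (\<lambda>k. X k j) \<longlonglongrightarrow> x j" "i < n" for X x i
      using \<open>a < b\<close> that by (intro tendsto_intros \<Phi>_cont h_cont h_range h_lim c) auto
  qed
  have nodes: "a + (b - a) * x i = \<Phi> (h x) (c i)" if "i < n" for i
    using fixed[OF that] \<open>a < b\<close> by (simp add: field_simps)
  have "\<bar>\<Phi> (h x) s - h x s\<bar> \<le> e" if "s \<in> S" for s
  proof -
    have "\<Phi> (h x) s - h x s = (\<Sum>i<n. \<Phi> (h x) s * \<phi> i s) - (\<Sum>i<n. \<Phi> (h x) (c i) * \<phi> i s)"
      using sum1[OF that] by (simp add: h_def nodes sum_distrib_left[symmetric])
    also have "\<dots> = (\<Sum>i<n. (\<Phi> (h x) s - \<Phi> (h x) (c i)) * \<phi> i s)"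
      by (simp add: sum_subtractf left_diff_distrib)
    also have "\<bar>\<dots>\<bar> \<le> (\<Sum>i<n. e * \<phi> i s)"
    proof (intro order_trans[OF sum_abs] sum_mono)
      fix i assume "i \<in> {..<n}"
      then have i: "i < n" by simp
      show "\<bar>(\<Phi> (h x) s - \<Phi> (h x) (c i)) * \<phi> i s\<bar> \<le> e * \<phi> i s"
      proof (cases "\<phi> i s = 0")
        case False
        from d[OF h_cont h_range c[OF i] that near[OF i that False], of x] x nonneg[OF i that]
        show ?thesis by (auto simp: abs_mult abs_minus_commute intro!: mult_right_mono)
      qed simp
    qed
    finally show ?thesis using sum1[OF that] by (simp add: sum_distrib_left[symmetric])
  qed
  then show ?thesis by (rule that[OF h_cont h_range[OF x]])
qed

theorem schauder_Icc:
  obtains h where "continuous_on S h" "h ` S \<subseteq> {a..b}" "\<And>s. s \<in> S \<Longrightarrow> \<Phi> h s = h s"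
proof -
  have "\<exists>h. continuous_on S h \<and> h ` S \<subseteq> {a..b} \<and> (\<forall>s\<in>S. \<bar>\<Phi> h s - h s\<bar> \<le> 1 / real (Suc n))" for n
    by (rule approximate_fixed_function[of "1 / real (Suc n)"]) auto
  then obtain H where H: "\<And>n. continuous_on S (H n)" "\<And>n. H n ` S \<subseteq> {a..b}"
    and approx: "\<And>n s. s \<in> S \<Longrightarrow> \<bar>\<Phi> (H n) s - H n s\<bar> \<le> 1 / real (Suc n)"
    by metis
  \<comment> \<open>Arzela-Ascoli is applied to the images \<open>\<Phi> (H n)\<close>, which are
    equicontinuous; the \<open>H n\<close> inherit the limit because the difference tends to 0
    uniformly.\<close>
  obtain g k where g: "continuous_on S g" and k: "strict_mono (k :: nat \<Rightarrow> nat)"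
    and lim: "\<And>e. 0 < e \<Longrightarrow> \<exists>N. \<forall>n x. n \<ge> N \<and> x \<in> S \<longrightarrow> norm (\<Phi> (H (k n)) x - g x) < e"
  proof (rule Arzela_Ascoli[OF \<open>compact S\<close>, of "\<lambda>n. \<Phi> (H n)" "\<bar>a\<bar> + \<bar>b\<bar>"])
    fix g and k :: "nat \<Rightarrow> nat"
    assume "continuous_on S g" "strict_mono k"
      "\<And>e. 0 < e \<Longrightarrow> \<exists>N. \<forall>n x. n \<ge> N \<and> x \<in> S \<longrightarrow> norm (\<Phi> (H (k n)) x - g x) < e"
    then show thesis by (rule that)
  next
    show "norm (\<Phi> (H n) s) \<le> \<bar>a\<bar> + \<bar>b\<bar>" if "s \<in> S" for n s
      using \<Phi>_range[OF H that, of n] by auto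
    show "\<exists>d>0. \<forall>n t. t \<in> S \<and> norm (s - t) < d \<longrightarrow> norm (\<Phi> (H n) s - \<Phi> (H n) t) < e"
      if "s \<in> S" "0 < e" for s e
    proof -
      from \<Phi>_equicont[OF that(2)] obtain d where "0 < d"
        and "\<And>h s t. \<lbrakk>continuous_on S h; h ` S \<subseteq> {a..b}; s \<in> S; t \<in> S; dist s t < d\<rbrakk>
          \<Longrightarrow> \<bar>\<Phi> h s - \<Phi> h t\<bar> < e"
        by blast
      with that(1) H show ?thesis by (intro exI[of _ d]) (auto simp: dist_norm)
    qed
  qed
  have unif: "uniform_limit S (\<lambda>n. \<Phi> (H (k n))) g sequentially"
    using lim by (intro uniform_limitI) (simp add: eventually_sequentially dist_norm, blast)
  have "uniform_limit S (\<lambda>n s. \<Phi> (H n) s - H n s) (\<lambda>s. 0) sequentially"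
  proof (rule uniform_limitI)
    fix e :: real assume "0 < e"
    with order_tendstoD(2)[OF lim_1_over_n[THEN LIMSEQ_Suc], of e]
    have "\<forall>\<^sub>F n in sequentially. 1 / real (Suc n) < e" by simp
    then show "\<forall>\<^sub>F n in sequentially. \<forall>s\<in>S. dist (\<Phi> (H n) s - H n s) 0 < e"
      by (rule eventually_mono) (auto simp: dist_real_def intro: le_less_trans[OF approx])
  qed
  then have "uniform_limit S (\<lambda>n s. \<Phi> (H (k n)) s - H (k n) s) (\<lambda>s. 0) sequentially"
    using filterlim_subseq[OF k] by (rule filterlim_compose)
  from uniform_limit_minus[OF unif this]
  have unifH: "uniform_limit S (\<lambda>n. H (k n)) g sequentially" by simp
  have lims: "(\<lambda>n. \<Phi> (H (k n)) s) \<longlonglongrightarrow> g s" "(\<lambda>n. H (k n) s) \<longlonglongrightarrow> g s" if "s \<in> S" for s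
    using tendsto_uniform_limitI[OF unif that] tendsto_uniform_limitI[OF unifH that] .
  have range: "g ` S \<subseteq> {a..b}"
  proof safe
    fix s assume "s \<in> S"
    show "g s \<in> {a..b}"
      using H(2) \<open>s \<in> S\<close>
      by (intro Lim_in_closed_set[OF closed_atLeastAtMost always_eventually _ lims(2)])
        (auto simp: image_subset_iff)
  qed
  have "\<Phi> g s = g s" if "s \<in> S" for s
    using LIMSEQ_unique[OF \<Phi>_cont[OF H(1) H(2) g range unifH that] lims(1)[OF that]] .
  then show ?thesis by (rule that[OF g range])
qed

end

section \<open>The Green's function\<close>

text \<open>In this form joint continuity is immediate, without gluing along the diagonal.\<close>

lemma G_eq: "G t s = (min s t)\<^sup>2 / 6 * (3 * max s t - min s t)"
  by (auto simp: G_def)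

lemma continuous_on_G [continuous_intros]:
  "\<lbrakk>continuous_on A g; continuous_on A h\<rbrakk> \<Longrightarrow> continuous_on A (\<lambda>x. G (g x) (h x))"
  unfolding G_eq by (intro continuous_intros) auto

text \<open>The weight M is a multiple of a section of the kernel, so bounds and moduli of
  continuity for G carry over to it.\<close>

lemma M_eq_G: "t \<le> 1 \<Longrightarrow> M t = 2 * G t 1"
  by (simp add: M_def G_eq field_simps)

lemma G_nonneg: "\<lbrakk>0 \<le> t; 0 \<le> s\<rbrakk> \<Longrightarrow> 0 \<le> G t s"
  by (auto simp: G_def)

lemma G_le_G_1:
  assumes "t \<in> {0..1}" "s \<in> {0..1}"
  shows "G t s \<le> G 1 s"
proof (cases "s \<le> t")
  case True
  then show ?thesis using assms by (auto simp: G_def intro!: mult_left_mono)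
next
  case False
  \<comment> \<open>The difference is split at \<open>G s s\<close>: the first summand is
    \<open>G 1 s - G s s\<close>, the second \<open>G s s - G t s\<close>.\<close>
  have "G 1 s - G t s =
      (1 - s) * s\<^sup>2 / 2 + (s - t) * (s\<^sup>2 + 2 * s * t + (s - t) * (s + t)) / 6"
    using False assms by (simp add: G_def power2_eq_square field_simps)
  moreover have "0 \<le> \<dots>" using assms False by (intro add_nonneg_nonneg) auto
  ultimately show ?thesis by linarith
qed

lemma G_1_le_1: "s \<in> {0..1} \<Longrightarrow> G 1 s \<le> 1"
  using mult_mono[of "s\<^sup>2" 1 "3 - s" 3] by (simp add: G_def power_le_one)

lemma G_le_1: "\<lbrakk>t \<in> {0..1}; s \<in> {0..1}\<rbrakk> \<Longrightarrow> G t s \<le> 1"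
  using G_le_G_1 G_1_le_1 by (meson order_trans)

lemma M_nonneg: "t \<in> {0..1} \<Longrightarrow> 0 \<le> M t"
  by (simp add: M_def)

lemma M_le: "t \<in> {0..1} \<Longrightarrow> M t \<le> 2 / 3"
  using G_le_G_1[of t 1] by (simp add: M_eq_G G_def[of 1 1])

lemma M_le_1: "t \<in> {0..1} \<Longrightarrow> M t \<le> 1"
  using M_le[of t] by simp

lemma continuous_on_M [continuous_intros]:
  "continuous_on A g \<Longrightarrow> continuous_on A (\<lambda>x. M (g x))"
  unfolding M_def by (intro continuous_intros) auto

text \<open>With the factor \<open>s\<^sup>2\<close> or \<open>t\<^sup>2\<close> removed, both cases
  rest on x (3 - x) \<le> 2 on [0,1], that is, (1 - x)(2 - x) \<ge> 0. Integrated, this is the lower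
  bound of J v by M.\<close>

lemma M_mult_G_1_le:
  assumes "t \<in> {0..1}" "s \<in> {0..1}"
  shows "M t * G 1 s \<le> G t s"
proof -
  have aux: "x * (3 - x) \<le> 2" if "x \<in> {0..1}" for x :: real
    using mult_nonneg_nonneg[of "1 - x" "2 - x"] that by (simp add: algebra_simps)
  show ?thesis
  proof (cases "s \<le> t")
    case True
    have "t * (t * (3 - t)) * (3 - s) \<le> t * 2 * (3 - s)"
      using aux[of t] assms by (intro mult_right_mono mult_left_mono) auto
    moreover have "0 \<le> t * s" using assms by auto
    ultimately have "t * (t * (3 - t)) * (3 - s) \<le> 3 * (3 * t - s)"
      using True by (simp add: algebra_simps)
    from mult_left_mono[OF this, of "s\<^sup>2 / 18"] True assms show ?thesis
      by (simp add: M_def G_def power2_eq_square field_simps)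
  next
    case False
    have "(3 - t) * (s * (s * (3 - s))) \<le> (3 - t) * (s * 2)"
      using aux[of s] assms by (intro mult_left_mono) auto
    moreover have "0 \<le> t * s" using assms by auto
    ultimately have "(3 - t) * (s * (s * (3 - s))) \<le> 3 * (3 * s - t)"
      using False by (simp add: algebra_simps)
    from mult_left_mono[OF this, of "t\<^sup>2 / 18"] False assms show ?thesis
      by (simp add: M_def G_def power2_eq_square field_simps)
  qed
qed

section \<open>Estimates for the integral operator J\<close>

lemma set_integrable_G_mult:
  "continuous_on {0..1} v \<Longrightarrow> set_integrable lebesgue {0..1} (\<lambda>s. G t s * v s)"
  by (intro absolutely_integrable_continuous_real continuous_intros)

text \<open>Integrability is a premise of its own so that \<open>f_lower\<close> is covered, for
  which it is extracted from the hypothesis at \<open>\<alpha>\<close>.\<close>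

lemma J_mono:
  assumes "set_integrable lebesgue {0..1} (\<lambda>s. G t s * v s)"
    "set_integrable lebesgue {0..1} (\<lambda>s. G t s * w s)"
    "0 \<le> t" "\<And>s. s \<in> {0..1} \<Longrightarrow> v s \<le> w s"
  shows "J v t \<le> J w t"
  unfolding J_def
  by (rule set_integral_mono) (use assms in \<open>auto intro!: mult_left_mono G_nonneg\<close>)

lemma set_integral_const_01: "(LINT s:{0..1::real}|lebesgue. c) = (c::real)"
proof -
  have "(\<lambda>s::real. c) absolutely_integrable_on {0..1}"
    by (intro absolutely_integrable_continuous_real continuous_intros)
  then show ?thesis by (simp add: set_lebesgue_integral_eq_integral(2))
qed

text \<open>Serves both moduli: equal v and w give equicontinuity in t, equal t and s give
  continuity in v. No constant enters, as the interval has length 1.\<close>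

lemma J_abs_diff_le:
  assumes v: "continuous_on {0..1} v" and w: "continuous_on {0..1} w"
    and le: "\<And>x. x \<in> {0..1} \<Longrightarrow> \<bar>G t x * v x - G s x * w x\<bar> \<le> e"
  shows "\<bar>J v t - J w s\<bar> \<le> e"
proof -
  note ints = set_integrable_G_mult[OF v, of t] set_integrable_G_mult[OF w, of s]
  have int: "set_integrable lebesgue {0..1} (\<lambda>x. G t x * v x - G s x * w x)"
    by (intro set_integral_diff ints)
  have const: "set_integrable lebesgue {0..1} (\<lambda>x::real. c :: real)" for c
    by (intro absolutely_integrable_continuous_real continuous_intros)
  have "J v t - J w s = (LINT x:{0..1}|lebesgue. G t x * v x - G s x * w x)"
    unfolding J_def using ints by (simp add: set_integral_diff)
  moreover have "(LINT x:{0..1}|lebesgue. G t x * v x - G s x * w x) \<le> (LINT x:{0..1::real}|lebesgue. e)"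
    by (rule set_integral_mono[OF int const]) (use le in force)
  moreover have "(LINT x:{0..1::real}|lebesgue. - e) \<le> (LINT x:{0..1}|lebesgue. G t x * v x - G s x * w x)"
    by (rule set_integral_mono[OF const int]) (use le in \<open>force simp: abs_le_iff\<close>)
  ultimately show ?thesis by (simp add: set_integral_const_01 abs_le_iff)
qed

lemma J_bounds:
  assumes v: "continuous_on {0..1} v" and nonneg: "\<And>s. s \<in> {0..1} \<Longrightarrow> 0 \<le> v s"
    and t: "t \<in> {0..1}"
  shows "0 \<le> J v t" and "J v t \<le> J v 1" and "M t * J v 1 \<le> J v t"
proof -
  note ints = set_integrable_G_mult[OF v]
  show "0 \<le> J v t"
    unfolding J_def set_lebesgue_integral_def
    using nonneg t by (intro Bochner_Integration.integral_nonneg) (auto simp: indicator_def G_nonneg)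
  show "J v t \<le> J v 1"
    unfolding J_def using nonneg t
    by (intro set_integral_mono ints mult_right_mono G_le_G_1) auto
  have "M t * J v 1 = (LINT s:{0..1}|lebesgue. M t * (G 1 s * v s))"
    unfolding J_def by simp
  also have "\<dots> \<le> J v t"
    unfolding J_def
  proof (intro set_integral_mono ints set_integrable_mult_right)
    fix s :: real assume s: "s \<in> {0..1}"
    show "M t * (G 1 s * v s) \<le> G t s * v s"
      using mult_right_mono[OF M_mult_G_1_le[OF t s] nonneg[OF s]] by (simp add: mult.assoc)
  qed
  finally show "M t * J v 1 \<le> J v t" .
qed

section \<open>Extrema over intervals and continuity of \<open>f_upper\<close>\<close>

lemma
  assumes "compact S" "S \<noteq> {}" "continuous_on S g"
  shows max_on_in_image: "max_on g S \<in> g ` S" and max_on_ge: "x \<in> S \<Longrightarrow> g x \<le> max_on g S"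
proof -
  obtain y where y: "y \<in> S" "\<And>z. z \<in> S \<Longrightarrow> g z \<le> g y"
    using continuous_attains_sup[OF assms] by auto
  have eq: "max_on g S = g y"
    unfolding max_on_def by (rule Greatest_equality) (use y in auto)
  show "max_on g S \<in> g ` S" "x \<in> S \<Longrightarrow> g x \<le> max_on g S"
    using y by (auto simp: eq)
qed

lemma min_on_le:
  assumes "compact S" "continuous_on S g" "x \<in> S"
  shows "min_on g S \<le> g x"
proof -
  obtain y where y: "y \<in> S" "\<And>z. z \<in> S \<Longrightarrow> g y \<le> g z"
    using continuous_attains_inf[OF assms(1) _ assms(2)] assms(3) by auto
  have "min_on g S = g y"
    unfolding min_on_def by (rule Least_equality) (use y in auto)
  then show ?thesis using y assms by auto
qed

context
  fixes f :: "real \<Rightarrow> real \<Rightarrow> real"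
  assumes f_cont: "continuous_on ({0..1} \<times> UNIV) (\<lambda>(t, u). f t u)"
begin

lemma continuous_on_f_comp:
  assumes "continuous_on A g" "continuous_on A h" "g ` A \<subseteq> {0..1}"
  shows "continuous_on A (\<lambda>x. f (g x) (h x))"
  using continuous_on_compose2[OF f_cont continuous_on_Pair[OF assms(1,2)]] assms(3) by auto

lemma f_uniformly_continuous:
  assumes "0 < e"
  obtains d where "0 < d"
    "\<And>s t x y. \<lbrakk>s \<in> {0..1}; t \<in> {0..1}; x \<in> {0..c}; y \<in> {0..c}; \<bar>s - t\<bar> < d; \<bar>x - y\<bar> < d\<rbrakk>
      \<Longrightarrow> \<bar>f s x - f t y\<bar> < e"
proof -
  have "uniformly_continuous_on ({0..1} \<times> {0..c}) (\<lambda>(t, u). f t u)"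
    by (intro compact_uniformly_continuous continuous_on_subset[OF f_cont] compact_Times) auto
  then obtain d where "0 < d" and d: "\<And>p q. \<lbrakk>p \<in> {0..1} \<times> {0..c}; q \<in> {0..1} \<times> {0..c};
      dist q p < d\<rbrakk> \<Longrightarrow> dist ((\<lambda>(t, u). f t u) q) ((\<lambda>(t, u). f t u) p) < e"
    using \<open>0 < e\<close> unfolding uniformly_continuous_on_def by metis
  show ?thesis
  \<comment> \<open>Halved because the distance in the product is bounded by the sum of the two
    coordinate distances.\<close>
  proof (rule that[of "d / 2"])
    fix s t x y assume *: "s \<in> {0..1}" "t \<in> {0..1}" "x \<in> {0..c}" "y \<in> {0..c}"
      "\<bar>s - t\<bar> < d / 2" "\<bar>x - y\<bar> < d / 2"
    have "dist (s, x) (t, y) \<le> \<bar>s - t\<bar> + \<bar>x - y\<bar>"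
      using sqrt_sum_squares_le_sum_abs[of "s - t" "x - y"]
      by (simp add: dist_Pair_Pair dist_real_def)
    with * d[of "(t, y)" "(s, x)"] show "\<bar>f s x - f t y\<bar> < e"
      by (simp add: dist_real_def)
  qed (use \<open>0 < d\<close> in simp)
qed

text \<open>Guarantees that \<open>J (f_upper f \<beta>) 1\<close> is a genuine integral: the
  default value 0 of a non-integrable integrand would satisfy the upper hypothesis without bounding
  anything.\<close>

lemma continuous_on_f_upper:
  assumes "0 \<le> \<beta>"
  shows "continuous_on {0..1} (f_upper f \<beta>)"
proof -
  have M\<beta>: "M t * \<beta> \<in> {0..\<beta>}" if "t \<in> {0..1}" for t
    using M_nonneg[OF that] M_le_1[OF that] assms by (auto intro: mult_left_le_one_le)
  have cont: "continuous_on {M t * \<beta>..\<beta>} (f t)" if "t \<in> {0..1}" for t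
    by (rule continuous_on_f_comp) (use that in \<open>auto intro: continuous_intros\<close>)
  note attained = max_on_in_image[OF compact_Icc _ cont] and ge = max_on_ge[OF compact_Icc _ cont]
  show ?thesis
    unfolding continuous_on_iff
  proof (intro ballI allI impI)
    fix t e :: real assume t: "t \<in> {0..1}" and "0 < e"
    obtain d where "0 < d" and d: "\<And>s t x y. \<lbrakk>s \<in> {0..1}; t \<in> {0..1}; x \<in> {0..\<beta>}; y \<in> {0..\<beta>};
        \<bar>s - t\<bar> < d; \<bar>x - y\<bar> < d\<rbrakk> \<Longrightarrow> \<bar>f s x - f t y\<bar> < e"
      using f_uniformly_continuous[OF \<open>0 < e\<close>] by blast
    have step: "f_upper f \<beta> a < f_upper f \<beta> b + e"
      if ab: "a \<in> {0..1}" "b \<in> {0..1}" "\<bar>a - b\<bar> < d" "\<bar>M a * \<beta> - M b * \<beta>\<bar> < d" for a b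
    proof -
      obtain u where u: "u \<in> {M a * \<beta>..\<beta>}" "f_upper f \<beta> a = f a u"
        using attained[OF _ ab(1)] M\<beta>[OF ab(1)] unfolding f_upper_def by auto
      \<comment> \<open>The maximiser u at a may lie below the interval for b. Raising it to that
        interval moves it by at most the shift of the left end point, hence by less than d.\<close>
      let ?u = "max u (M b * \<beta>)"
      have "f b ?u \<le> f_upper f \<beta> b"
        unfolding f_upper_def using u M\<beta>[OF ab(2)] ab(2) by (intro ge) auto
      moreover have "\<bar>f a u - f b ?u\<bar> < e"
        using u M\<beta>[OF ab(1)] M\<beta>[OF ab(2)] ab by (intro d) auto
      ultimately show ?thesis using u by linarith
    qed
    have "continuous_on {0..1} (\<lambda>t. M t * \<beta>)" by (intro continuous_intros)
    then obtain d' where "0 < d'"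
      and d': "\<And>s. s \<in> {0..1} \<Longrightarrow> \<bar>s - t\<bar> < d' \<Longrightarrow> \<bar>M s * \<beta> - M t * \<beta>\<bar> < d"
      using t \<open>0 < d\<close> unfolding continuous_on_iff dist_real_def by metis
    show "\<exists>d>0. \<forall>s\<in>{0..1}. dist s t < d \<longrightarrow> dist (f_upper f \<beta> s) (f_upper f \<beta> t) < e"
    proof (intro exI[of _ "min d d'"] conjI ballI impI)
      fix s :: real assume s: "s \<in> {0..1}" "dist s t < min d d'"
      with step[of s t] step[of t s] d'[of s] t
      show "dist (f_upper f \<beta> s) (f_upper f \<beta> t) < e"
        by (auto simp: dist_real_def abs_minus_commute abs_less_iff)
    qed (use \<open>0 < d\<close> \<open>0 < d'\<close> in simp)
  qed
qed

end

section \<open>The boundary value problem\<close>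

text \<open>Agreement is required only on [0,1], so the second conclusion serves as the first
  premise for the next derivative.\<close>

lemma deriv01_eq:
  assumes "\<And>t. t \<in> {0..1} \<Longrightarrow> u t = w t"
    and "\<And>t. t \<in> {0..1} \<Longrightarrow> (w has_real_derivative w' t) (at t within {0..1})"
  shows "u differentiable_on {0..1}" and "t \<in> {0..1} \<Longrightarrow> deriv01 u t = w' t"
proof -
  have der: "(u has_real_derivative w' t) (at t within {0..1})" if "t \<in> {0..1}" for t
    unfolding has_field_derivative_def
    by (rule has_derivative_transform[OF that assms(1) assms(2)[OF that, unfolded has_field_derivative_def]])
  show "u differentiable_on {0..1}"
    using der unfolding differentiable_on_def differentiable_def has_field_derivative_def by blast
  show "deriv01 u t = w' t" if "t \<in> {0..1}"
    unfolding deriv01_def using der[OF that] that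
    by (intro vector_derivative_within_closed_interval)
      (simp_all add: has_real_derivative_iff_has_vector_derivative)
qed

text \<open>Expanding both branches of G in powers of s takes t out of the integrands, leaving
  moments whose derivatives are given by the fundamental theorem of calculus.\<close>

lemma J_moments:
  assumes v: "continuous_on {0..1} v" and t: "t \<in> {0..1}"
  shows "J v t = t / 2 * integral {0..t} (\<lambda>s. s\<^sup>2 * v s) - integral {0..t} (\<lambda>s. s ^ 3 * v s) / 6
    + t\<^sup>2 / 2 * integral {t..1} (\<lambda>s. s * v s) - t ^ 3 / 6 * integral {t..1} v"
proof -
  have cont: "continuous_on {a..b} (\<lambda>s. g s * v s)"
    if "{a..b} \<subseteq> {0..1}" "continuous_on UNIV g" for g a b
    using that by (intro continuous_intros continuous_on_subset[OF v] continuous_on_subset[OF that(2)]) auto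
  note int = integrable_continuous_real[OF cont]
  have "J v t = integral {0..1} (\<lambda>s. G t s * v s)"
    unfolding J_def by (rule set_lebesgue_integral_eq_integral(2)[OF set_integrable_G_mult[OF v]])
  also have "\<dots> = integral {0..t} (\<lambda>s. G t s * v s) + integral {t..1} (\<lambda>s. G t s * v s)"
    using t by (intro Henstock_Kurzweil_Integration.integral_combine[symmetric] int continuous_intros) auto
  also have "integral {0..t} (\<lambda>s. G t s * v s) =
      integral {0..t} (\<lambda>s. t / 2 * (s\<^sup>2 * v s) - s ^ 3 * v s / 6)"
    by (intro integral_cong) (auto simp: G_def power2_eq_square power3_eq_cube field_simps)
  also have "\<dots> = t / 2 * integral {0..t} (\<lambda>s. s\<^sup>2 * v s) - integral {0..t} (\<lambda>s. s ^ 3 * v s) / 6"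
    using t by (subst integral_diff) (auto intro!: integrable_on_divide integrable_on_mult_right int continuous_intros)
  \<comment> \<open>The end point s = t falls under the other branch of \<open>G_def\<close>, but
    both branches agree there.\<close>
  also have "integral {t..1} (\<lambda>s. G t s * v s) =
      integral {t..1} (\<lambda>s. t\<^sup>2 / 2 * (s * v s) - t ^ 3 / 6 * v s)"
    by (intro integral_cong) (auto simp: G_def power2_eq_square power3_eq_cube field_simps)
  also have "\<dots> = t\<^sup>2 / 2 * integral {t..1} (\<lambda>s. s * v s) - t ^ 3 / 6 * integral {t..1} v"
    using t int[of t 1 "\<lambda>_. 1"]
    by (subst integral_diff) (auto intro!: integrable_on_mult_right int continuous_intros)
  finally show ?thesis by simp
qed

text \<open>In the first three derivatives the terms containing v cancel, so continuity of v
  suffices. The boundary values vanish because A and B at 0, and C and D at 1, are integrals over a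
  single point.\<close>

lemma J_solves_beam:
  assumes v: "continuous_on {0..1} v" and u: "\<And>t. t \<in> {0..1} \<Longrightarrow> u t = J v t"
  shows "C_k01 4 u" and "\<forall>t\<in>{0..1}. (deriv01 ^^ 4) u t = v t"
    and "u 0 = 0" "deriv01 u 0 = 0" "(deriv01 ^^ 2) u 1 = 0" "(deriv01 ^^ 3) u 1 = 0"
proof -
  define A where "A t = integral {0..t} (\<lambda>s. s\<^sup>2 * v s)" for t
  define B where "B t = integral {0..t} (\<lambda>s. s ^ 3 * v s)" for t
  define C where "C t = integral {t..1} (\<lambda>s. s * v s)" for t
  define D where "D t = integral {t..1} v" for t
  have ders:
    "(A has_real_derivative t\<^sup>2 * v t) (at t within {0..1})"
    "(B has_real_derivative t ^ 3 * v t) (at t within {0..1})"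
    "(C has_real_derivative - (t * v t)) (at t within {0..1})"
    "(D has_real_derivative - v t) (at t within {0..1})" if "t \<in> {0..1}" for t
    unfolding A_def B_def C_def D_def
    by (intro integral_has_real_derivative integral_has_real_derivative' continuous_intros v that)+
  have u0: "u t = t / 2 * A t - B t / 6 + t\<^sup>2 / 2 * C t - t ^ 3 / 6 * D t" if "t \<in> {0..1}" for t
    unfolding u[OF that] A_def B_def C_def D_def by (rule J_moments[OF v that])
  have "((\<lambda>t. t / 2 * A t - B t / 6 + t\<^sup>2 / 2 * C t - t ^ 3 / 6 * D t) has_real_derivative
      A t / 2 + t * C t - t\<^sup>2 / 2 * D t) (at t within {0..1})" if "t \<in> {0..1}" for t
    by (auto intro!: derivative_eq_intros ders[OF that] simp: power2_eq_square power3_eq_cube field_simps)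
  note u1 = deriv01_eq[OF u0 this]
  have "((\<lambda>t. A t / 2 + t * C t - t\<^sup>2 / 2 * D t) has_real_derivative
      C t - t * D t) (at t within {0..1})" if "t \<in> {0..1}" for t
    by (auto intro!: derivative_eq_intros ders[OF that] simp: power2_eq_square field_simps)
  note u2 = deriv01_eq[OF u1(2) this]
  have "((\<lambda>t. C t - t * D t) has_real_derivative - D t) (at t within {0..1})" if "t \<in> {0..1}" for t
    by (auto intro!: derivative_eq_intros ders[OF that] simp: field_simps)
  note u3 = deriv01_eq[OF u2(2) this]
  have "((\<lambda>t. - D t) has_real_derivative v t) (at t within {0..1})" if "t \<in> {0..1}" for t
    by (auto intro!: derivative_eq_intros ders[OF that])
  note u4 = deriv01_eq[OF u3(2) this]
  have iter: "(deriv01 ^^ 2) u = deriv01 (deriv01 u)"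
    "(deriv01 ^^ 3) u = deriv01 (deriv01 (deriv01 u))"
    "(deriv01 ^^ 4) u = deriv01 (deriv01 (deriv01 (deriv01 u)))"
    by (simp_all add: numeral_eq_Suc)
  show d4: "\<forall>t\<in>{0..1}. (deriv01 ^^ 4) u t = v t"
    using u4(2) by (simp add: iter)
  have "continuous_on {0..1} ((deriv01 ^^ 4) u)"
    using v by (rule continuous_on_eq) (use d4 in simp)
  moreover have "(deriv01 ^^ j) u differentiable_on {0..1}" if "j < 4" for j
  proof -
    from that consider "j = 0" | "j = 1" | "j = 2" | "j = 3" by linarith
    then show ?thesis using u1(1) u2(1) u3(1) u4(1) by cases (simp_all add: iter)
  qed
  ultimately show "C_k01 4 u" by (simp add: C_k01_def)
  show "u 0 = 0" "deriv01 u 0 = 0" "(deriv01 ^^ 2) u 1 = 0" "(deriv01 ^^ 3) u 1 = 0"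
    using u0[of 0] u1(2)[of 0] u2(2)[of 1] u3(2)[of 1]
    by (simp_all add: iter A_def B_def C_def D_def)
qed

section \<open>The fixed point in polar form\<close>

text \<open>In the interior the clamp is inactive and the increment must be 0. At an end, being
  fixed excludes an inward increment, and the last two premises exclude an outward one.\<close>

lemma fixed_point_by_clamping:
  fixes r \<rho> R0 R1 \<sigma> :: real
  assumes "R0 < R1" "R0 \<le> r" "r \<le> R1" "\<sigma> \<noteq> 0"
    and "r = min R1 (max R0 (r + \<sigma> * (\<rho> - r)))"
    and "r = R0 \<Longrightarrow> 0 \<le> \<sigma> * (\<rho> - r)" "r = R1 \<Longrightarrow> \<sigma> * (\<rho> - r) \<le> 0"
  shows "\<rho> = r"
proof -
  have "\<sigma> * (\<rho> - r) = 0"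
    using assms(1-3,5-7) by (auto simp: min_def max_def split: if_splits)
  then show ?thesis using \<open>\<sigma> \<noteq> 0\<close> by simp
qed

lemma abs_clamp_diff_less:
  fixes a b c :: real
  assumes "\<bar>a - a'\<bar> < d" "\<bar>b - b'\<bar> < d" "\<bar>c - c'\<bar> < d"
  shows "\<bar>min a (max b c) - min a' (max b' c')\<bar> < d"
  using assms unfolding min_def max_def abs_less_iff by auto

text \<open>The premise \<open>ends\<close> carries all that is used of \<open>\<alpha>\<close> and
  \<open>\<beta>\<close>: at both end radii the signed radial increment does not point out of
  \<open>{R0..R1}\<close>.\<close>

lemma positive_beam_fixed_point:
  fixes f :: "real \<Rightarrow> real \<Rightarrow> real" and R0 R1 \<sigma> :: real
  assumes f_cont: "continuous_on ({0..1} \<times> UNIV) (\<lambda>(t, u). f t u)"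
    and f_nonneg: "\<And>t x. \<lbrakk>t \<in> {0..1}; 0 \<le> x\<rbrakk> \<Longrightarrow> 0 \<le> f t x"
    and R: "0 < R0" "R0 < R1" and "\<sigma> \<noteq> 0"
    and ends: "\<And>r u. \<lbrakk>r = R0 \<or> r = R1; continuous_on {0..1} u;
        \<And>t. t \<in> {0..1} \<Longrightarrow> u t \<in> {M t * r..r}\<rbrakk>
        \<Longrightarrow> if r = R0 then 0 \<le> \<sigma> * (J (\<lambda>s. f s (u s)) 1 - r) else \<sigma> * (J (\<lambda>s. f s (u s)) 1 - r) \<le> 0"
  obtains r u where "r \<in> {R0..R1}" "continuous_on {0..1} u" "u 1 = r"
    "\<And>t. t \<in> {0..1} \<Longrightarrow> u t \<in> {M t * r..r}"
    "\<And>t. t \<in> {0..1} \<Longrightarrow> u t = J (\<lambda>s. f s (u s)) t"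
proof -
  \<comment> \<open>In polar form h = r w: clamping U h makes the operator total on all continuous h, and 3/2 M,
    which lies between M and 1 and equals 1 at 1, replaces the missing mass when \<rho> h < R0.\<close>
  define r where "r h = min R1 (max R0 (h 1))" for h :: "real \<Rightarrow> real"
  define U where "U h t = min (r h) (max (M t * r h) (h t))" for h t
  define v where "v h s = f s (U h s)" for h s
  define \<rho> where "\<rho> h = J (v h) 1" for h
  define r' where "r' h = min R1 (max R0 (r h + \<sigma> * (\<rho> h - r h)))" for h
  define w where "w h t = (J (v h) t + max 0 (R0 - \<rho> h) * (3 / 2 * M t)) / max (\<rho> h) R0" for h t
  define \<Phi> where "\<Phi> h t = r' h * w h t" for h t
  have r_range: "r h \<in> {R0..R1}" and r'_range: "r' h \<in> {R0..R1}" for h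
    using R by (auto simp: r_def r'_def)
  have U_bounds: "U h t \<in> {M t * r h..r h}" if "t \<in> {0..1}" for h t
    using r_range[of h] R M_le_1[OF that] mult_left_le_one_le[of "r h" "M t"] M_nonneg[OF that]
    by (auto simp: U_def)
  have U_range: "U h t \<in> {0..R1}" if "t \<in> {0..1}" for h t
    using U_bounds[OF that, of h] r_range[of h] R mult_nonneg_nonneg[OF M_nonneg[OF that], of "r h"]
    by auto
  have U_cont: "continuous_on {0..1} (U h)" if "continuous_on {0..1} h" for h
    unfolding U_def by (intro continuous_intros that)
  have v_cont: "continuous_on {0..1} (v h)" if "continuous_on {0..1} h" for h
    unfolding v_def by (intro continuous_on_f_comp[OF f_cont] continuous_intros U_cont that) auto
  have v_nonneg: "0 \<le> v h s" if "s \<in> {0..1}" for h s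
    using f_nonneg[OF that] U_range[OF that] by (auto simp: v_def)
  have J_v: "J (v h) t \<le> J (v h) 1" "M t * J (v h) 1 \<le> J (v h) t" "0 \<le> J (v h) t"
    if "continuous_on {0..1} h" "t \<in> {0..1}" for h t
    using J_bounds[OF v_cont[OF that(1)] v_nonneg that(2)] by auto
  have \<rho>_nonneg: "0 \<le> \<rho> h" if "continuous_on {0..1} h" for h
    unfolding \<rho>_def using J_v(3)[OF that] by simp
  have w_range: "w h t \<in> {M t..1}" if h: "continuous_on {0..1} h" and t: "t \<in> {0..1}" for h t
  proof -
    have "max 0 (R0 - \<rho> h) * (3 / 2 * M t) \<le> max 0 (R0 - \<rho> h)"
      using M_le[OF t] by (intro mult_left_le) auto
    moreover have "max 0 (R0 - \<rho> h) * M t \<le> max 0 (R0 - \<rho> h) * (3 / 2 * M t)"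
      using M_nonneg[OF t] by (intro mult_left_mono) auto
    moreover have eq: "max (\<rho> h) R0 = \<rho> h + max 0 (R0 - \<rho> h)" by auto
    moreover have "M t * max (\<rho> h) R0 = M t * \<rho> h + max 0 (R0 - \<rho> h) * M t"
      unfolding eq by (simp add: algebra_simps)
    ultimately have "M t * max (\<rho> h) R0 \<le> J (v h) t + max 0 (R0 - \<rho> h) * (3 / 2 * M t)"
      "J (v h) t + max 0 (R0 - \<rho> h) * (3 / 2 * M t) \<le> max (\<rho> h) R0"
      using J_v(1,2)[OF h t] unfolding \<rho>_def[symmetric] by linarith+
    moreover have "0 < max (\<rho> h) R0" using R by auto
    ultimately show ?thesis by (simp add: w_def pos_le_divide_eq pos_divide_le_eq)
  qed
  \<comment> \<open>As \<open>3 / 2 * M 1 = 1\<close>, the numerator at 1 is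
    \<open>\<rho> h + max 0 (R0 - \<rho> h)\<close>, which is the denominator.\<close>
  have w_1: "w h 1 = 1" for h
    using R by (auto simp: w_def \<rho>_def[symmetric] M_def max_def)
  have "\<exists>h. continuous_on {0..1} h \<and> h ` {0..1} \<subseteq> {0..R1} \<and> (\<forall>t\<in>{0..1}. \<Phi> h t = h t)"
  proof (rule schauder_Icc[of "{0..1::real}" 0 R1 \<Phi>])
    show "\<Phi> h t \<in> {0..R1}" if "continuous_on {0..1} h" "t \<in> {0..1}" for h t
      using w_range[OF that] M_nonneg[OF that(2)] r'_range[of h] R
        mult_mono[of "r' h" R1 "w h t" 1] by (auto simp: \<Phi>_def)
  next
    fix e :: real assume "0 < e"
    have "compact ((\<lambda>(t, u). f t u) ` ({0..1} \<times> {0..R1}))"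
      by (intro compact_continuous_image continuous_on_subset[OF f_cont] compact_Times) auto
    from compact_imp_bounded[OF this] obtain B where "0 < B"
      and "\<And>y. y \<in> (\<lambda>(t, u). f t u) ` ({0..1} \<times> {0..R1}) \<Longrightarrow> norm y \<le> B"
      unfolding bounded_pos by blast
    then have B: "\<bar>f t x\<bar> \<le> B" if "t \<in> {0..1}" "x \<in> {0..R1}" for t x
      using that by (force simp: image_iff)
    \<comment> \<open>Chosen to give e / 2 in the end: R1 bounds \<open>r' h\<close>, R0 bounds the
      denominator from below, B bounds the integrand \<open>v h\<close>, and 3 * R0 comes from the
      correction term.\<close>
    define e' where "e' = e * R0 / (2 * R1 * (B + 3 * R0))"
    have "0 < B + 3 * R0" using \<open>0 < B\<close> R by simp
    then have "0 < e'" using \<open>0 < e\<close> R by (simp add: e'_def)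
    have "uniformly_continuous_on ({0..1} \<times> {0..1}) (\<lambda>p. G (fst p) (snd p))"
      by (intro compact_uniformly_continuous continuous_intros compact_Times) auto
    then obtain d where "0 < d" and d: "\<And>p q. \<lbrakk>p \<in> {0..1} \<times> {0..1}; q \<in> {0..1} \<times> {0..1};
        dist q p < d\<rbrakk> \<Longrightarrow> dist (G (fst q) (snd q)) (G (fst p) (snd p)) < e'"
      using \<open>0 < e'\<close> unfolding uniformly_continuous_on_def by metis
    have G_close: "\<bar>G s x - G t x\<bar> \<le> e'"
      if "s \<in> {0..1}" "t \<in> {0..1}" "x \<in> {0..1}" "dist s t < d" for s t x
      using d[of "(t, x)" "(s, x)"] that by (simp add: dist_Pair_Pair dist_real_def)
    have "\<bar>\<Phi> h s - \<Phi> h t\<bar> < e"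
      if h: "continuous_on {0..1} h" and st: "s \<in> {0..1}" "t \<in> {0..1}" "dist s t < d" for h s t
    proof -
      define m where "m = max 0 (R0 - \<rho> h)"
      define c where "c = max (\<rho> h) R0"
      define N where "N t = J (v h) t + m * (3 / 2 * M t)" for t
      have m: "0 \<le> m" "m \<le> R0" and c: "R0 \<le> c"
        using \<rho>_nonneg[OF h] R by (auto simp: m_def c_def)
      have \<Phi>_eq: "\<Phi> h t = r' h * (N t / c)" for t
        by (simp add: \<Phi>_def w_def m_def c_def N_def)
      have J_close: "\<bar>J (v h) s - J (v h) t\<bar> \<le> e' * B"
      proof (rule J_abs_diff_le[OF v_cont[OF h] v_cont[OF h]])
        fix x :: real assume x: "x \<in> {0..1}"
        have "\<bar>G s x * v h x - G t x * v h x\<bar> = \<bar>G s x - G t x\<bar> * \<bar>v h x\<bar>"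
          by (simp add: abs_mult left_diff_distrib[symmetric])
        also have "\<dots> \<le> e' * B"
          using G_close[OF st(1,2) x st(3)] B[OF x U_range[OF x]] \<open>0 < e'\<close>
          by (intro mult_mono) (auto simp: v_def)
        finally show "\<bar>G s x * v h x - G t x * v h x\<bar> \<le> e' * B" .
      qed
      \<comment> \<open>Since \<open>3 / 2 * M t = 3 * G t 1\<close>, the modulus found for G also
        controls the correction.\<close>
      have "m * (3 / 2 * M s) - m * (3 / 2 * M t) = m * (3 * (G s 1 - G t 1))"
        using st(1,2) by (simp add: M_eq_G algebra_simps)
      also have "\<bar>\<dots>\<bar> = m * (3 * \<bar>G s 1 - G t 1\<bar>)"
        unfolding abs_mult using m(1) by simp
      also have "\<dots> \<le> R0 * (3 * e')"
        using G_close[OF st(1,2) _ st(3), of 1] m R by (intro mult_mono) auto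
      finally have M_close: "\<bar>m * (3 / 2 * M s) - m * (3 / 2 * M t)\<bar> \<le> R0 * (3 * e')" .
      have "e' * (B + 3 * R0) = e' * B + R0 * (3 * e')" by (simp add: algebra_simps)
      with J_close M_close have num: "\<bar>N s - N t\<bar> \<le> e' * (B + 3 * R0)"
        unfolding N_def by linarith
      have "\<Phi> h s - \<Phi> h t = r' h * ((N s - N t) / c)"
        unfolding \<Phi>_eq by (simp add: diff_divide_distrib right_diff_distrib)
      also have "\<bar>\<dots>\<bar> = r' h * (\<bar>N s - N t\<bar> / c)"
        using r'_range[of h] R c by (simp add: abs_mult)
      also have "\<dots> \<le> R1 * (e' * (B + 3 * R0) / R0)"
        using r'_range[of h] R c num \<open>0 < e'\<close> \<open>0 < B + 3 * R0\<close>
        by (intro mult_mono frac_le) auto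
      also have "\<dots> = e / 2"
        using R \<open>0 < B + 3 * R0\<close> by (simp add: e'_def)
      also have "\<dots> < e" using \<open>0 < e\<close> by simp
      finally show ?thesis .
    qed
    then show "\<exists>d>0. \<forall>h s t. continuous_on {0..1} h \<longrightarrow> h ` {0..1} \<subseteq> {0..R1} \<longrightarrow>
        s \<in> {0..1} \<longrightarrow> t \<in> {0..1} \<longrightarrow> dist s t < d \<longrightarrow> \<bar>\<Phi> h s - \<Phi> h t\<bar> < e"
      using \<open>0 < d\<close> by blast
  next
    fix H :: "nat \<Rightarrow> real \<Rightarrow> real" and h :: "real \<Rightarrow> real" and t :: real
    assume H: "\<And>n. continuous_on {0..1} (H n)" and h: "continuous_on {0..1} h"
      and unif: "uniform_limit {0..1} H h sequentially" and t: "t \<in> {0..1}"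
    have r_lim: "(\<lambda>n. r (H n)) \<longlonglongrightarrow> r h"
      unfolding r_def by (intro tendsto_intros tendsto_uniform_limitI[OF unif]) auto
    have J_lim: "(\<lambda>n. J (v (H n)) t) \<longlonglongrightarrow> J (v h) t" if t: "t \<in> {0..1}" for t
    proof (rule tendstoI)
      fix e :: real assume "0 < e"
      then obtain d where "0 < d" and d: "\<And>s t x y. \<lbrakk>s \<in> {0..1}; t \<in> {0..1}; x \<in> {0..R1};
          y \<in> {0..R1}; \<bar>s - t\<bar> < d; \<bar>x - y\<bar> < d\<rbrakk> \<Longrightarrow> \<bar>f s x - f t y\<bar> < e / 2"
        using f_uniformly_continuous[OF f_cont, of "e / 2"] by (metis half_gt_zero)
      from uniform_limitD[OF unif \<open>0 < d\<close>]
      show "\<forall>\<^sub>F n in sequentially. dist (J (v (H n)) t) (J (v h) t) < e"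
      proof (rule eventually_mono)
        fix n assume close: "\<forall>x\<in>{0..1}. dist (H n x) (h x) < d"
        have "\<bar>H n 1 - h 1\<bar> < d" using close by (simp add: dist_real_def)
        then have rd: "\<bar>r (H n) - r h\<bar> < d" using \<open>0 < d\<close> unfolding r_def by (intro abs_clamp_diff_less) auto
        have "\<bar>J (v (H n)) t - J (v h) t\<bar> \<le> e / 2"
        proof (rule J_abs_diff_le[OF v_cont[OF H] v_cont[OF h]])
          fix s :: real assume s: "s \<in> {0..1}"
          have "\<bar>M s * r (H n) - M s * r h\<bar> \<le> \<bar>r (H n) - r h\<bar>"
            using M_nonneg[OF s] M_le_1[OF s]
            by (simp add: right_diff_distrib[symmetric] abs_mult mult_left_le_one_le)
          moreover have "\<bar>H n s - h s\<bar> < d" using close s by (simp add: dist_real_def)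
          ultimately have "\<bar>U (H n) s - U h s\<bar> < d" using rd unfolding U_def by (intro abs_clamp_diff_less) auto
          then have "\<bar>v (H n) s - v h s\<bar> < e / 2"
            unfolding v_def using \<open>0 < d\<close> by (intro d s U_range) auto
          moreover have "\<bar>G t s * v (H n) s - G t s * v h s\<bar> \<le> \<bar>v (H n) s - v h s\<bar>"
            using G_nonneg[of t s] G_le_1[OF t s] t s
            by (simp add: right_diff_distrib[symmetric] abs_mult mult_left_le_one_le)
          ultimately show "\<bar>G t s * v (H n) s - G t s * v h s\<bar> \<le> e / 2" by linarith
        qed
        then show "dist (J (v (H n)) t) (J (v h) t) < e" using \<open>0 < e\<close> by (simp add: dist_real_def)
      qed
    qed
    then have \<rho>_lim: "(\<lambda>n. \<rho> (H n)) \<longlonglongrightarrow> \<rho> h" unfolding \<rho>_def by simp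
    show "(\<lambda>n. \<Phi> (H n) t) \<longlonglongrightarrow> \<Phi> h t"
      unfolding \<Phi>_def r'_def w_def using R
      by (intro tendsto_intros r_lim \<rho>_lim J_lim t) auto
  qed (use R in auto)
  then obtain h where h: "continuous_on {0..1} h" and fixed: "\<And>t. t \<in> {0..1} \<Longrightarrow> \<Phi> h t = h t"
    by auto
  have "h 1 = r' h" using fixed[of 1] by (simp add: \<Phi>_def w_1)
  \<comment> \<open>The value at 1 already lies in \<open>{R0..R1}\<close>, so the clamp in
    \<open>r\<close> leaves it alone; this is the radial equation.\<close>
  then have r_eq: "r h = r' h" using r'_range[of h] by (auto simp: r_def)
  have h_eq: "h t = r h * w h t" if "t \<in> {0..1}" for t
    using fixed[OF that] by (simp add: \<Phi>_def r_eq)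
  have h_bounds: "h t \<in> {M t * r h..r h}" if "t \<in> {0..1}" for t
  proof -
    have "r h * M t \<le> r h * w h t" "r h * w h t \<le> r h * 1"
      using w_range[OF h that] r_range[of h] R by (auto intro!: mult_left_mono)
    then show ?thesis by (simp add: h_eq[OF that] mult.commute)
  qed
  \<comment> \<open>The fixed point satisfies the bounds that \<open>U\<close> enforces, so the
    auxiliary nonlinearity is f itself along it.\<close>
  have U_eq: "U h t = h t" if "t \<in> {0..1}" for t
    using h_bounds[OF that] by (simp add: U_def)
  have J_cong: "J (v h) = J (\<lambda>s. f s (h s))"
    unfolding J_def by (intro ext set_lebesgue_integral_cong) (auto simp: v_def U_eq)
  have "\<rho> h = r h"
  proof (rule fixed_point_by_clamping[OF R(2) _ _ \<open>\<sigma> \<noteq> 0\<close>])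
    show "r h = min R1 (max R0 (r h + \<sigma> * (\<rho> h - r h)))" using r_eq r'_def by simp
    show "0 \<le> \<sigma> * (\<rho> h - r h)" if "r h = R0"
      using ends[OF _ h h_bounds] that unfolding \<rho>_def J_cong by auto
    show "\<sigma> * (\<rho> h - r h) \<le> 0" if "r h = R1"
      using ends[OF _ h h_bounds] that R unfolding \<rho>_def J_cong by auto
  qed (use r_range[of h] in auto)
  \<comment> \<open>With \<open>\<rho> h = r h \<ge> R0\<close> the correction vanishes and the
    denominator is \<open>r h\<close>, which cancels the radius.\<close>
  then have "h t = J (\<lambda>s. f s (h s)) t" if "t \<in> {0..1}" for t
    using h_eq[OF that] r_range[of h] R by (simp add: w_def J_cong)
  moreover have "h 1 = r h" using h_eq[of 1] by (simp add: w_1)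
  ultimately show ?thesis using that[of "r h" h] h h_bounds r_range by blast
qed

section \<open>The two integral hypotheses as end-point conditions on the radius\<close>

theorem theorem3p5:
  fixes f :: "real \<Rightarrow> real \<Rightarrow> real" and \<alpha> \<beta> :: real
  assumes f_cont: "continuous_on ({0..1} \<times> UNIV) (\<lambda>(t, u). f t u)"
    and f_nonneg: "\<forall>t\<in>{0..1}. f t ` {0..} \<subseteq> {0..}"
    and pos: "0 < \<alpha>" "0 < \<beta>"
    and neq: "\<alpha> \<noteq> \<beta>"
    and lower: "\<alpha> \<le> J (f_lower f \<alpha>) 1"
    and upper: "\<beta> \<ge> J (f_upper f \<beta>) 1"
  shows "\<exists>u. bvp_solution f u \<and> positive01 u \<and>
           min \<alpha> \<beta> \<le> sup_norm u \<and> sup_norm u \<le> max \<alpha> \<beta>"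
proof -
  have f_cont_comp: "continuous_on {0..1} (\<lambda>s. f s (u s))" if "continuous_on {0..1} u" for u
    by (intro continuous_on_f_comp[OF f_cont] continuous_intros that) auto
  have f_cont_section: "continuous_on A (f t)" if "t \<in> {0..1}" for t A
    by (rule continuous_on_f_comp[OF f_cont]) (use that in \<open>auto intro: continuous_intros\<close>)
  have at_\<alpha>: "\<alpha> \<le> J (\<lambda>s. f s (u s)) 1"
    if u: "continuous_on {0..1} u" "\<And>t. t \<in> {0..1} \<Longrightarrow> u t \<in> {M t * \<alpha>..\<alpha>}" for u
  proof -
    have "set_integrable lebesgue {0..1} (\<lambda>s. G 1 s * f_lower f \<alpha> s)"
    proof (rule ccontr)
      \<comment> \<open>a non-integrable integrand would make J vanish\<close>
      assume "\<not> ?thesis"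
      then have "J (f_lower f \<alpha>) 1 = 0"
        unfolding J_def set_lebesgue_integral_def set_integrable_def by (rule not_integrable_integral_eq)
      with lower pos show False by simp
    qed
    moreover have "f_lower f \<alpha> s \<le> f s (u s)" if "s \<in> {0..1}" for s
      unfolding f_lower_def by (rule min_on_le[OF compact_Icc f_cont_section u(2)]) (fact that)+
    ultimately have "J (f_lower f \<alpha>) 1 \<le> J (\<lambda>s. f s (u s)) 1"
      by (intro J_mono[OF _ set_integrable_G_mult[OF f_cont_comp[OF u(1)]]]) auto
    with lower show ?thesis by simp
  qed
  have at_\<beta>: "J (\<lambda>s. f s (u s)) 1 \<le> \<beta>"
    if u: "continuous_on {0..1} u" "\<And>t. t \<in> {0..1} \<Longrightarrow> u t \<in> {M t * \<beta>..\<beta>}" for u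
  proof -
    have "f s (u s) \<le> f_upper f \<beta> s" if "s \<in> {0..1}" for s
      unfolding f_upper_def using u(2)[OF that]
      by (intro max_on_ge[OF compact_Icc _ f_cont_section[OF that]]) auto
    then have "J (\<lambda>s. f s (u s)) 1 \<le> J (f_upper f \<beta>) 1"
      using pos by (intro J_mono set_integrable_G_mult f_cont_comp u continuous_on_f_upper[OF f_cont]) auto
    with upper show ?thesis by simp
  qed
  obtain r u where r: "r \<in> {min \<alpha> \<beta>..max \<alpha> \<beta>}" and u: "continuous_on {0..1} u"
    "u 1 = r"
    "\<And>t. t \<in> {0..1} \<Longrightarrow> u t \<in> {M t * r..r}"
    "\<And>t. t \<in> {0..1} \<Longrightarrow> u t = J (\<lambda>s. f s (u s)) t"
  \<comment> \<open>For \<open>\<alpha> < \<beta>\<close> the bounds at the two ends point into the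
    interval as they stand; for \<open>\<beta> < \<alpha>\<close> both point outwards and the factor
    - 1 reverses them.\<close>
  proof (rule positive_beam_fixed_point[OF f_cont, of "min \<alpha> \<beta>" "max \<alpha> \<beta>" "if \<alpha> < \<beta> then 1 else - 1"])
    fix r u assume "r \<in> {min \<alpha> \<beta>..max \<alpha> \<beta>}" "continuous_on {0..1} u"
      "u 1 = r"
      "\<And>t. t \<in> {0..1} \<Longrightarrow> u t \<in> {M t * r..r}"
      "\<And>t. t \<in> {0..1} \<Longrightarrow> u t = J (\<lambda>s. f s (u s)) t"
    then show thesis by (rule that)
  next
    fix r u assume r: "r = min \<alpha> \<beta> \<or> r = max \<alpha> \<beta>" and "continuous_on {0..1} u"
      and "\<And>t. t \<in> {0..1} \<Longrightarrow> u t \<in> {M t * r..r}"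
    then have "r = \<alpha> \<Longrightarrow> \<alpha> \<le> J (\<lambda>s. f s (u s)) 1" "r = \<beta> \<Longrightarrow> J (\<lambda>s. f s (u s)) 1 \<le> \<beta>"
      using at_\<alpha>[of u] at_\<beta>[of u] by auto
    then show "if r = min \<alpha> \<beta>
        then 0 \<le> (if \<alpha> < \<beta> then 1 else - 1) * (J (\<lambda>s. f s (u s)) 1 - r)
        else (if \<alpha> < \<beta> then 1 else - 1) * (J (\<lambda>s. f s (u s)) 1 - r) \<le> 0"
      using r neq by (cases "\<alpha> < \<beta>") (auto simp: min_def max_def)
  qed (use f_nonneg pos neq in \<open>auto simp: image_subset_iff min_def max_def\<close>)
  have "0 < r" using r pos by auto
  have nonneg: "0 \<le> u t" if "t \<in> {0..1}" for t
    using u(3)[OF that] mult_nonneg_nonneg[OF M_nonneg[OF that], of r] \<open>0 < r\<close> by auto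
  note beam = J_solves_beam[OF f_cont_comp[OF u(1)] u(4)]
  have "bvp_solution f u"
    unfolding bvp_solution_def using beam by auto
  moreover have "positive01 u"
    unfolding positive01_def using nonneg u(2) \<open>0 < r\<close> by (auto intro!: bexI[of _ 1])
  moreover have "sup_norm u = r"
    unfolding sup_norm_def max_on_def
  proof (rule Greatest_equality)
    show "r \<in> (\<lambda>t. \<bar>u t\<bar>) ` {0..1}"
      using u(2) \<open>0 < r\<close> by (intro image_eqI[of _ _ 1]) auto
    show "y \<le> r" if "y \<in> (\<lambda>t. \<bar>u t\<bar>) ` {0..1}" for y
      using that nonneg u(3) by auto
  qed
  ultimately show ?thesis using r by auto
qed

end
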